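(* Let $g(x)=\frac{x}{x+1}$ for $x\ge 0$. For all integers $n>0$ and $m$ with $0\le m\le\binom n2$, the quasi-complete graph $QK(n,m)$ uniquely minimizes $\Sigma_g$ over $\mathbb{G}(n,m)$.
   Context: Graphs are finite and simple, with vertex set $\{1,\dots,n\}$; $\mathbb{G}(n,m)$ is the set of graphs with $n$ vertices and $m$ edges. For a graph with degree sequence $d=(d_1,\dots,d_n)$, $\Sigma_g(d)=\sum_{i=1}^n g(d_i)$. A graph $G\in\mathbb{G}(n,m)$ uniquely minimizes $\Sigma_g$ over $\mathbb{G}(n,m)$ if its degree sequence attains the minimum of $\Sigma_g$ among all degree sequences of graphs in $\mathbb{G}(n,m)$ and, up to isomorphism, $G$ is the only graph in $\mathbb{G}(n,m)$ whose degree sequence does so. $QK(n,m)$ is the graph on $\{1,\dots,n\}$ such that, with $q,r$ the unique integers satisfying $m=\binom q2+r$, $0\le r\le q-1$, the vertices $1,\dots,q$ induce a complete graph, vertex $q+1$ (if $q<n$) is adjacent exactly to $1,\dots,r$, and vertices $q+2,\dots,n$ are isolated. *)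

theory Defs
  imports Complex_Main "HOL-Library.Ramsey"
begin

text \<open>
  A simple graph on the vertex set \<open>{1..n}\<close> is given by its set of edges, which are two-element
  subsets of \<open>{1..n}\<close> (that is, members of \<^term>\<open>nsets {1..n} 2\<close>).
\<close>

definition graphs :: "nat \<Rightarrow> nat \<Rightarrow> nat set set set" where
  "graphs n m = {G. G \<subseteq> nsets {1..n} 2 \<and> card G = m}"

definition degree :: "nat set set \<Rightarrow> nat \<Rightarrow> nat" where
  "degree G v = card {e \<in> G. v \<in> e}"

definition degree_sequence :: "nat \<Rightarrow> nat set set \<Rightarrow> nat list" where
  "degree_sequence n G = map (degree G) [1..<Suc n]"

definition graph_iso :: "nat \<Rightarrow> nat set set \<Rightarrow> nat set set \<Rightarrow> bool" where
  "graph_iso n G H \<longleftrightarrow> (\<exists>f. bij_betw f {1..n} {1..n} \<and> (`) f ` G = H)"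

definition Sigma_deg :: "(real \<Rightarrow> real) \<Rightarrow> nat list \<Rightarrow> real" where
  "Sigma_deg g d = (\<Sum>x\<leftarrow>d. g (real x))"

definition attains_min :: "(real \<Rightarrow> real) \<Rightarrow> nat \<Rightarrow> nat \<Rightarrow> nat set set \<Rightarrow> bool" where
  "attains_min g n m G \<longleftrightarrow>
     is_arg_min (Sigma_deg g) (\<lambda>d. d \<in> degree_sequence n ` graphs n m) (degree_sequence n G)"

definition uniquely_minimizes :: "(real \<Rightarrow> real) \<Rightarrow> nat \<Rightarrow> nat \<Rightarrow> nat set set \<Rightarrow> bool" where
  "uniquely_minimizes g n m G \<longleftrightarrow>
     G \<in> graphs n m \<and> attains_min g n m G \<and>
     (\<forall>H \<in> graphs n m. attains_min g n m H \<longrightarrow> graph_iso n G H)"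

text \<open>
  The condition \<open>0 \<le> r \<le> q - 1\<close> over the integers forces \<open>q \<ge> 1\<close>; over the natural numbers it
  is \<open>r < q\<close>.  For \<open>m = 0\<close> this gives \<open>(q, r) = (1, 0)\<close>.
\<close>

definition qk_params :: "nat \<Rightarrow> nat \<times> nat" where
  "qk_params m = (THE (q, r). m = (q choose 2) + r \<and> r < q)"

definition QK :: "nat \<Rightarrow> nat \<Rightarrow> nat set set" where
  "QK n m = (let (q, r) = qk_params m in
     nsets {1..q} 2 \<union> (if q < n then (\<lambda>i. {i, q + 1}) ` {1..r} else {}))"

lemma choose_two_Suc: "Suc q choose 2 = (q choose 2) + q"
  by (simp add: numeral_2_eq_2)

lemma choose_two_mono: "q \<le> q' \<Longrightarrow> q choose 2 \<le> (q' choose 2)"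
  by (induction rule: dec_induct) (auto simp: choose_two_Suc)

lemma qk_decomp_ex: "\<exists>q r. m = (q choose 2) + r \<and> r < q"
proof (induction m)
  case 0
  have "0 = (1 choose 2) + (0::nat) \<and> (0::nat) < 1"
    by (simp add: binomial_eq_0)
  then show ?case by blast
next
  case (Suc m)
  then obtain q r where qr: "m = (q choose 2) + r" "r < q" by blast
  show ?case
  proof (cases "Suc r < q")
    case True
    then have "Suc m = (q choose 2) + Suc r \<and> Suc r < q" using qr by simp
    then show ?thesis by blast
  next
    case False
    then have "Suc m = (Suc q choose 2) + 0 \<and> 0 < Suc q"
      using qr by (simp add: choose_two_Suc)
    then show ?thesis by blast
  qed
qed

lemma qk_decomp_le:
  assumes "(q choose 2) + r = (q' choose 2) + r'" "r' < q'"
  shows "q \<le> q'"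
proof (rule ccontr)
  assume "\<not> q \<le> q'"
  then have "Suc q' choose 2 \<le> (q choose 2)" by (intro choose_two_mono) simp
  with assms show False by (simp add: choose_two_Suc)
qed

lemma qk_params_eqI:
  assumes "m = (q choose 2) + r" "r < q"
  shows "qk_params m = (q, r)"
  unfolding qk_params_def
proof (rule the_equality)
  show "case (q, r) of (q, r) \<Rightarrow> m = (q choose 2) + r \<and> r < q"
    using assms by simp
next
  fix p :: "nat \<times> nat"
  assume p: "case p of (q, r) \<Rightarrow> m = (q choose 2) + r \<and> r < q"
  obtain q' r' where [simp]: "p = (q', r')" by (cases p)
  have *: "m = (q' choose 2) + r'" "r' < q'" using p by auto
  have "q = q'"
    using qk_decomp_le[of q r q' r'] qk_decomp_le[of q' r' q r] * assms by simp
  then show "p = (q, r)" using * assms by simp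
qed

lemma card_nsets_two: "card (nsets {1..q::nat} 2) = q choose 2"
proof -
  have "nsets {1..q} 2 = {N. N \<subseteq> {1..q} \<and> card N = 2}"
    using finite_subset by (fastforce simp: nsets_def)
  then show ?thesis by (simp add: n_subsets)
qed

lemma QK_in_graphs:
  assumes "m \<le> n choose 2" "n > 0"
  shows "QK n m \<in> graphs n m"
proof -
  obtain q r where qr: "m = (q choose 2) + r" "r < q"
    using qk_decomp_ex by blast
  have params: "qk_params m = (q, r)" by (rule qk_params_eqI[OF qr])
  show ?thesis
  proof (cases "q < n")
    case True
    let ?S = "(\<lambda>i. {i, q + 1}) ` {1..r}"
    have eq: "QK n m = nsets {1..q} 2 \<union> ?S"
      using True by (simp add: QK_def params)
    have sub: "QK n m \<subseteq> nsets {1..n} 2"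
    proof -
      have "nsets {1..q} 2 \<subseteq> nsets {1..n} 2" using True by (intro nsets_mono) auto
      moreover have "?S \<subseteq> nsets {1..n} 2" using True qr by auto
      ultimately show ?thesis unfolding eq by blast
    qed
    have "inj_on (\<lambda>i. {i, q + 1}) {1..r}"
      by (auto simp: inj_on_def doubleton_eq_iff)
    then have cS: "card ?S = r" by (simp add: card_image)
    have "nsets {1..q} 2 \<inter> ?S = {}" by auto
    then have "card (QK n m) = (q choose 2) + r"
      unfolding eq using cS
      by (subst card_Un_disjoint) (simp_all add: finite_imp_finite_nsets card_nsets_two del: One_nat_def)
    then show ?thesis using sub qr by (simp add: graphs_def)
  next
    case False
    then have "n choose 2 \<le> (q choose 2)" by (intro choose_two_mono) simp
    then have "r = 0" "n choose 2 = (q choose 2)" using assms qr by auto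
    have "q = n"
    proof (rule ccontr)
      assume "q \<noteq> n"
      then have "Suc n choose 2 \<le> (q choose 2)" using False by (intro choose_two_mono) simp
      then show False using \<open>n choose 2 = (q choose 2)\<close> assms by (simp add: choose_two_Suc)
    qed
    then have "QK n m = nsets {1..n} 2" by (simp add: QK_def params)
    then show ?thesis using \<open>r = 0\<close> \<open>q = n\<close> qr card_nsets_two[of n]
      by (simp add: graphs_def)
  qed
qed

end

(*
  If no vertex is isolated and m <= C(n-1,2), take a vertex v of minimum degree k and
  replace its k edges by k non-edges avoiding v.  With g(x) = x/(x+1), this gains g(k) = k/(k+1) at v
  and costs at most 2k/((k+1)(k+2)) elsewhere, so a minimizer has an isolated vertex, and induction
  on n applies.  If m >= C(n-1,2), the complement K has c < n edges; writing h for its degrees,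
  g(n-1-h) = (n-1)/n - h/(n(n-h)), so minimizing means maximizing the sum over the edges xy of K of
  1/(n-h(x)) + 1/(n-h(y)).  Since h(x) + h(y) <= c+1, convexity makes the star the only optimum, and
  the complement of a star is quasi-complete.
*)
theory Submission
  imports Defs "HOL-Combinatorics.Transposition"
begin

section \<open>Minimization restated as a vertex sum\<close>

definition weight :: "nat \<Rightarrow> nat set set \<Rightarrow> real" where
  "weight n G = (\<Sum>v\<in>{1..n}. real (degree G v) / (real (degree G v) + 1))"

definition minimal :: "nat \<Rightarrow> nat \<Rightarrow> nat set set \<Rightarrow> bool" where
  "minimal n m G \<longleftrightarrow> G \<in> graphs n m \<and> (\<forall>H\<in>graphs n m. weight n G \<le> weight n H)"

lemma Sigma_deg_eq_weight:
  "Sigma_deg (\<lambda>x. x / (x + 1)) (degree_sequence n G) = weight n G"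
proof -
  have "set [1..<Suc n] = {1..n}" by auto
  then show ?thesis
    unfolding Sigma_deg_def degree_sequence_def weight_def map_map comp_def
    by (subst sum_list_distinct_conv_sum_set) (auto simp del: upt_Suc)
qed

text \<open>The admissible degree sequences are exactly the image of \<open>graphs n m\<close>, so
  minimizing over sequences and minimizing over graphs yield the same comparisons.\<close>

lemma attains_min_iff_minimal:
  assumes "G \<in> graphs n m"
  shows "attains_min (\<lambda>x. x / (x + 1)) n m G \<longleftrightarrow> minimal n m G"
  using assms
  by (auto simp: attains_min_def minimal_def is_arg_min_def Sigma_deg_eq_weight not_less)

lemma finite_graphs: "finite (graphs n m)"
  by (rule finite_subset[of _ "Pow (nsets {1..n} 2)"])
    (auto simp: graphs_def finite_imp_finite_nsets)

lemma finite_graph: "G \<in> graphs n m \<Longrightarrow> finite G"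
  using finite_subset[OF _ finite_imp_finite_nsets[of "{1..n}" 2]] by (auto simp: graphs_def)

lemma minimal_exists:
  assumes "graphs n m \<noteq> {}"
  obtains G where "minimal n m G"
proof -
  obtain G where "is_arg_min (weight n) (\<lambda>G. G \<in> graphs n m) G"
    using ex_is_arg_min_if_finite[OF finite_graphs assms] by blast
  then have "minimal n m G"
    by (auto simp: minimal_def is_arg_min_def not_less)
  then show thesis by (rule that)
qed

section \<open>Counting degrees\<close>

text \<open>Double counting of the incident pairs \<open>(v, e)\<close>. With \<open>f = 1\<close>
  this is the handshake identity; with \<open>f v = 1 / (n - degree K v)\<close> it turns the weight
  of a graph into a sum over the edges of its complement.\<close>

lemma sum_degree_weighted:
  fixes f :: "nat \<Rightarrow> real"
  assumes "K \<subseteq> nsets V 2" "finite V"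
  shows "(\<Sum>v\<in>V. real (degree K v) * f v) = (\<Sum>e\<in>K. \<Sum>v\<in>e. f v)"
proof -
  have fin: "finite K" using assms finite_imp_finite_nsets finite_subset by blast
  have "(\<Sum>v\<in>V. real (degree K v) * f v) = (\<Sum>v\<in>V. \<Sum>e\<in>{e\<in>K. v \<in> e}. f v)"
    by (simp add: degree_def)
  also have "\<dots> = (\<Sum>e\<in>K. \<Sum>v\<in>{v\<in>V. v \<in> e}. f v)"
    by (rule sum.swap_restrict[OF assms(2) fin])
  also have "\<dots> = (\<Sum>e\<in>K. \<Sum>v\<in>e. f v)"
  proof (rule sum.cong[OF refl])
    fix e assume "e \<in> K"
    then have "{v\<in>V. v \<in> e} = e" using assms by (auto simp: nsets_def)
    then show "(\<Sum>v\<in>{v\<in>V. v \<in> e}. f v) = (\<Sum>v\<in>e. f v)" by simp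
  qed
  finally show ?thesis .
qed

lemma degree_Un_disjoint:
  assumes "finite A" "finite B" "A \<inter> B = {}"
  shows "degree (A \<union> B) v = degree A v + degree B v"
proof -
  have "{e \<in> A \<union> B. v \<in> e} = {e \<in> A. v \<in> e} \<union> {e \<in> B. v \<in> e}" by auto
  then show ?thesis using assms unfolding degree_def
    by (simp, subst card_Un_disjoint) auto
qed

lemma degree_outside:
  assumes "G \<subseteq> nsets V 2" "v \<notin> V"
  shows "degree G v = 0"
proof -
  have "{e \<in> G. v \<in> e} = {}" using assms by (fastforce simp: nsets_def)
  then show ?thesis by (simp only: degree_def card.empty)
qed

lemma degree_complete:
  assumes "finite V" "v \<in> V"
  shows "degree (nsets V 2) v = card V - 1"
proof -
  have "{e \<in> nsets V 2. v \<in> e} = (\<lambda>w. {v, w}) ` (V - {v})"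
    using assms(2) by (auto simp: nsets_def card_2_iff)
  moreover have "inj_on (\<lambda>w. {v, w}) (V - {v})" by (auto simp: inj_on_def doubleton_eq_iff)
  ultimately show ?thesis using assms by (simp add: degree_def card_image)
qed

text \<open>Only the edge \<open>{x, y}\<close> can contain both \<open>x\<close> and
  \<open>y\<close>, so adding the two degrees counts at most one edge of \<open>K\<close>
  twice.\<close>

lemma degree_edge_sum_le:
  assumes "finite K" "{x, y} \<in> K" "K \<subseteq> nsets V 2" "x \<noteq> y"
  shows "degree K x + degree K y \<le> card K + 1"
proof -
  let ?A = "{e\<in>K. x \<in> e}" and ?B = "{e\<in>K. y \<in> e}"
  have "?A \<inter> ?B \<subseteq> {{x, y}}"
    using assms(3,4) by (auto simp: nsets_def card_2_iff)
  then have "card (?A \<inter> ?B) \<le> 1" using card_mono[of "{{x, y}}" "?A \<inter> ?B"] by simp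
  moreover have "card (?A \<union> ?B) \<le> card K" by (rule card_mono[OF assms(1)]) auto
  moreover have "card ?A + card ?B = card (?A \<union> ?B) + card (?A \<inter> ?B)"
    by (rule card_Un_Int) (use assms(1) in auto)
  ultimately show ?thesis by (simp add: degree_def)
qed

section \<open>Stars maximize the edge sum of the complement\<close>

text \<open>Convexity of \<open>1 / (n - t)\<close>: the sum of two values grows when
  \<open>b\<close> is raised to \<open>c + 1 - a\<close> and the pair is then spread to the extremes
  \<open>c\<close> and \<open>1\<close>. Spreading fixes the sum of the two denominators and lowers
  their product by \<open>(a - 1) * (c - a)\<close>.\<close>

lemma reciprocal_pair_less:
  fixes a b c n :: nat
  assumes "1 \<le> a" "1 \<le> b" "a + b \<le> c + 1" "c < n" "a < c" "b < c"
  shows "1 / (real n - a) + 1 / (real n - b) < 1 / (real n - c) + 1 / (real n - 1)"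
proof -
  define N A B C where "N = real n" and "A = real a" and "B = real b" and "C = real c"
  have r: "1 \<le> A" "1 \<le> B" "A + B \<le> C + 1" "C + 1 \<le> N" "A < C" "B < C"
    using assms by (auto simp: A_def B_def C_def N_def)
  have "1 / (N - A) + 1 / (N - B) < 1 / (N - C) + 1 / (N - 1)"
  proof (cases "A = 1")
    \<comment> \<open>The product gap \<open>(A - 1) * (C - A)\<close> vanishes here, so strictness
      has to come from \<open>B < C\<close>.\<close>
    case True
    have "1 / (N - B) < 1 / (N - C)" using r by (intro divide_strict_left_mono) auto
    then show ?thesis using True by simp
  next
    case False
    let ?M = "1 / (N - A) + 1 / (N - (C + 1 - A))"
    have "1 / (N - A) + 1 / (N - B) \<le> ?M"
      using r by (intro add_left_mono divide_left_mono) auto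
    also have "?M = (2 * N - C - 1) / ((N - A) * (N - (C + 1 - A)))"
      using r by (auto simp: divide_simps)
    also have "(N - A) * (N - (C + 1 - A)) = (N - C) * (N - 1) + (A - 1) * (C - A)"
      by (simp add: algebra_simps)
    also have "(2 * N - C - 1) / \<dots> < (2 * N - C - 1) / ((N - C) * (N - 1))"
      using r False by (intro divide_strict_left_mono mult_pos_pos add_pos_pos) auto
    also have "\<dots> = 1 / (N - C) + 1 / (N - 1)"
      using r by (auto simp: divide_simps)
    finally show ?thesis .
  qed
  then show ?thesis by (simp add: N_def A_def B_def C_def)
qed

text \<open>A vertex of degree \<open>h\<close> in \<open>K\<close> has degree
  \<open>n - 1 - h\<close> in \<open>G\<close> and contributes
  \<open>(n - 1) / n - h / (n * (n - h))\<close>. The factor \<open>h\<close> turns the vertex sum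
  into an edge sum, so a smaller weight means a larger edge sum over the complement.\<close>

lemma weight_via_complement:
  assumes "G \<subseteq> nsets {1..n} 2" "n > 0"
  defines "K \<equiv> nsets {1..n} 2 - G"
  shows "weight n G = real n - 1 -
    (\<Sum>e\<in>K. \<Sum>v\<in>e. 1 / (real n - degree K v)) / real n"
proof -
  have fin: "finite (nsets {1..n} 2)" by (simp add: finite_imp_finite_nsets)
  have deg: "degree G v + degree K v = n - 1" if "v \<in> {1..n}" for v
  proof -
    have "degree (G \<union> K) v = degree G v + degree K v"
      using assms(1) fin by (intro degree_Un_disjoint) (auto simp: K_def intro: finite_subset)
    moreover have "G \<union> K = nsets {1..n} 2" using assms(1) by (auto simp: K_def)
    ultimately show ?thesis using degree_complete[of "{1..n}" v] that by simp
  qed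
  have "weight n G = (\<Sum>v\<in>{1..n}. (real n - 1) / real n
      - real (degree K v) * (1 / (real n - degree K v)) / real n)"
    unfolding weight_def
  proof (rule sum.cong[OF refl])
    fix v assume "v \<in> {1..n}"
    from deg[OF this] have d: "real (degree G v) = real n - 1 - real (degree K v)"
      "real (degree K v) < real n" using assms(2) by linarith+
    then show "real (degree G v) / (real (degree G v) + 1) = (real n - 1) / real n
      - real (degree K v) * (1 / (real n - degree K v)) / real n"
      using assms(2) unfolding d(1) by (simp add: field_simps)
  qed
  also have "\<dots> = real n - 1 -
      (\<Sum>v\<in>{1..n}. real (degree K v) * (1 / (real n - degree K v))) / real n"
    by (subst sum_subtractf, subst sum_divide_distrib) (use assms(2) in simp)
  also have "(\<Sum>v\<in>{1..n}. real (degree K v) * (1 / (real n - degree K v)))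
      = (\<Sum>e\<in>K. \<Sum>v\<in>e. 1 / (real n - degree K v))"
    by (rule sum_degree_weighted) (auto simp: K_def)
  finally show ?thesis .
qed

text \<open>The centre has degree \<open>card K\<close> and each leaf degree 1, so all edges
  contribute the same amount.\<close>

lemma edge_sum_star:
  assumes "K \<subseteq> nsets {1..n} 2" "u \<in> {1..n}" "\<forall>e\<in>K. u \<in> e" "card K < n"
  shows "(\<Sum>e\<in>K. \<Sum>v\<in>e. 1 / (real n - degree K v))
    = real (card K) * (1 / (real n - card K) + 1 / (real n - 1))"
proof -
  have "(\<Sum>v\<in>e. 1 / (real n - degree K v)) = 1 / (real n - card K) + 1 / (real n - 1)"
    if e: "e \<in> K" for e
  proof -
    have "{e \<in> K. u \<in> e} = K" using assms(3) by auto
    then have du: "degree K u = card K" by (simp add: degree_def)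
    have edge: "\<exists>y. e' = {u, y} \<and> y \<noteq> u" if "e' \<in> K" for e'
    proof -
      have "e' \<in> nsets {1..n} 2" "u \<in> e'" using that assms(1,3) by auto
      then show ?thesis by (elim nsets2_E) auto
    qed
    then obtain x where x: "e = {u, x}" "x \<noteq> u" using e by blast
    have "{e \<in> K. x \<in> e} = {e}"
    proof
      show "{e \<in> K. x \<in> e} \<subseteq> {e}" using edge x by blast
    qed (use e x in auto)
    then have "degree K x = 1" by (simp add: degree_def)
    with du x show ?thesis by simp
  qed
  then show ?thesis by simp
qed

text \<open>Every vertex misses some edge, hence all degrees lie strictly below
  \<open>card K\<close>, and \<open>reciprocal_pair_less\<close> bounds each edge strictly by the
  contribution of an edge of a star.\<close>

lemma edge_sum_non_star:
  assumes K: "K \<subseteq> nsets {1..n} 2" and ns: "\<not> (\<exists>u\<in>{1..n}. \<forall>e\<in>K. u \<in> e)"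
    and "card K < n"
  shows "(\<Sum>e\<in>K. \<Sum>v\<in>e. 1 / (real n - degree K v))
    < real (card K) * (1 / (real n - card K) + 1 / (real n - 1))"
proof -
  have fin: "finite K" using K finite_imp_finite_nsets finite_subset by blast
  \<comment> \<open>The empty graph is a star around any vertex; vertex 1 exists because
    \<open>card K < n\<close>. Strictness of the total needs at least one edge.\<close>
  have ne: "K \<noteq> {}"
  proof
    assume "K = {}"
    moreover have "1 \<in> {1..n}" using assms(3) by simp
    ultimately show False using ns by blast
  qed
  have lt: "degree K v < card K" if v: "v \<in> {1..n}" for v
  proof -
    obtain e where "e \<in> K" "v \<notin> e" using ns v by blast
    then have "{e \<in> K. v \<in> e} \<subset> K" by blast
    then show ?thesis unfolding degree_def by (rule psubset_card_mono[OF fin])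
  qed
  have "(\<Sum>e\<in>K. \<Sum>v\<in>e. 1 / (real n - degree K v))
    < (\<Sum>e\<in>K. 1 / (real n - card K) + 1 / (real n - 1))"
  proof (rule sum_strict_mono[OF fin ne])
    fix e assume e: "e \<in> K"
    with K have "e \<in> nsets {1..n} 2" by blast
    then obtain x y where xy: "e = {x, y}" "x \<in> {1..n}" "y \<in> {1..n}" "x \<noteq> y"
      by (rule nsets2_E)
    have pos: "1 \<le> degree K v" if "v \<in> e" for v
    proof -
      have "{e} \<subseteq> {e\<in>K. v \<in> e}" using e that by auto
      then have "card {e} \<le> card {e\<in>K. v \<in> e}" by (rule card_mono[rotated]) (use fin in auto)
      then show ?thesis by (simp add: degree_def)
    qed
    have degs: "1 \<le> degree K x" "1 \<le> degree K y" "degree K x + degree K y \<le> card K + 1"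
      using pos degree_edge_sum_le[OF fin e[unfolded xy(1)] K xy(4)] xy(1) by auto
    then have "1 / (real n - degree K x) + 1 / (real n - degree K y)
        < 1 / (real n - card K) + 1 / (real n - 1)"
      using degs by (intro reciprocal_pair_less lt xy(2,3) assms(3))
    moreover have "(\<Sum>v\<in>e. 1 / (real n - degree K v))
        = 1 / (real n - degree K x) + 1 / (real n - degree K y)"
      using xy(4) unfolding xy(1) by simp
    ultimately show "(\<Sum>v\<in>e. 1 / (real n - degree K v))
        < 1 / (real n - card K) + 1 / (real n - 1)" by simp
  qed
  also have "\<dots> = real (card K) * (1 / (real n - card K) + 1 / (real n - 1))"
    by (rule sum_constant)
  finally show ?thesis .
qed

section \<open>Isomorphisms of stars and of complements\<close>

lemma star_eq_image:
  assumes "K \<subseteq> nsets V 2" "\<forall>e\<in>K. u \<in> e"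
  obtains X where "X \<subseteq> V - {u}" "K = (\<lambda>x. {u, x}) ` X" "card X = card K"
proof -
  let ?X = "{x. {u, x} \<in> K}"
  have "?X \<subseteq> V - {u}" using assms by (auto simp: nsets_def)
  moreover have K: "K = (\<lambda>x. {u, x}) ` ?X"
  proof
    show "K \<subseteq> (\<lambda>x. {u, x}) ` ?X"
    proof
      fix e assume e: "e \<in> K"
      then have "e \<in> nsets V 2" "u \<in> e" using assms by auto
      then obtain x where "e = {u, x}" by (elim nsets2_E) auto
      with e show "e \<in> (\<lambda>x. {u, x}) ` ?X" by blast
    qed
  qed auto
  moreover have "inj_on (\<lambda>x. {u, x}) ?X" by (auto simp: inj_on_def doubleton_eq_iff)
  then have "card ?X = card K" by (metis K card_image)
  ultimately show thesis by (rule that)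
qed

text \<open>Three bijections are glued: centre to centre, leaves to leaves, and remaining vertices
  to remaining vertices. The last two exist because the sets have equal size.\<close>

lemma stars_isomorphic:
  assumes K: "K \<subseteq> nsets {1..n} 2" "u \<in> {1..n}" "\<forall>e\<in>K. u \<in> e"
    and L: "L \<subseteq> nsets {1..n} 2" "w \<in> {1..n}" "\<forall>e\<in>L. w \<in> e"
    and "card K = card L"
  shows "graph_iso n K L"
proof -
  let ?V = "{1..n}"
  obtain X where X: "X \<subseteq> ?V - {u}" "K = (\<lambda>x. {u, x}) ` X" "card X = card K"
    using star_eq_image[OF K(1,3)] .
  obtain Y where Y: "Y \<subseteq> ?V - {w}" "L = (\<lambda>x. {w, x}) ` Y" "card Y = card L"
    using star_eq_image[OF L(1,3)] .
  have fin: "finite X" "finite Y" using X Y finite_subset by blast+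
  obtain f where f: "bij_betw f X Y"
    using fin X Y assms(7) finite_same_card_bij by metis
  have "card (?V - {u} - X) = card (?V - {w} - Y)"
    using X Y K(2) L(2) fin assms(7) by (simp add: card_Diff_subset)
  then obtain g where g: "bij_betw g (?V - {u} - X) (?V - {w} - Y)"
    using finite_same_card_bij by (metis finite_Diff finite_atLeastAtMost)
  define h where "h x = (if x = u then w else if x \<in> X then f x else g x)" for x
  have hu: "bij_betw h {u} {w}" by (simp add: h_def)
  have hX: "bij_betw h X Y"
    using f by (rule bij_betw_cong[THEN iffD1, rotated]) (use X in \<open>auto simp: h_def\<close>)
  have hR: "bij_betw h (?V - {u} - X) (?V - {w} - Y)"
    using g by (rule bij_betw_cong[THEN iffD1, rotated]) (auto simp: h_def)
  have "bij_betw h ({u} \<union> X \<union> (?V - {u} - X)) ({w} \<union> Y \<union> (?V - {w} - Y))"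
    by (intro bij_betw_combine hu hX hR) (use Y in auto)
  moreover have "{u} \<union> X \<union> (?V - {u} - X) = ?V" "{w} \<union> Y \<union> (?V - {w} - Y) = ?V"
    using X Y K(2) L(2) by auto
  ultimately have "bij_betw h ?V ?V" by simp
  moreover have "(`) h ` K = L"
  proof -
    have "h u = w" by (simp add: h_def)
    then have "(`) h ` K = (\<lambda>x. {w, h x}) ` X" by (simp add: X(2) image_image)
    also have "\<dots> = (\<lambda>y. {w, y}) ` (h ` X)" by (simp add: image_image)
    also have "h ` X = Y" using hX by (rule bij_betw_imp_surj_on)
    finally show ?thesis by (simp add: Y(2))
  qed
  ultimately show ?thesis unfolding graph_iso_def by blast
qed

text \<open>A vertex permutation permutes all pairs, so taking images commutes with
  complementation.\<close>

lemma graph_iso_of_complements: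
  assumes "G \<subseteq> nsets {1..n} 2" "H \<subseteq> nsets {1..n} 2"
    "graph_iso n (nsets {1..n} 2 - G) (nsets {1..n} 2 - H)"
  shows "graph_iso n G H"
proof -
  let ?N = "nsets {1..n} 2"
  obtain f where f: "bij_betw f {1..n} {1..n}" "(`) f ` (?N - G) = ?N - H"
    using assms(3) unfolding graph_iso_def by blast
  have b: "bij_betw ((`) f) ?N ?N" using bij_betw_nsets[OF f(1)] .
  have "(`) f ` G = (`) f ` (?N - (?N - G))" using assms(1) by (simp add: double_diff)
  also have "\<dots> = (`) f ` ?N - (`) f ` (?N - G)"
    using b by (intro inj_on_image_set_diff) (auto simp: bij_betw_def)
  also have "\<dots> = ?N - (?N - H)" using f(2) b by (simp add: bij_betw_def)
  also have "\<dots> = H" using assms(2) by (simp add: double_diff)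
  finally show ?thesis using f(1) unfolding graph_iso_def by blast
qed

section \<open>Invariance under relabelling\<close>

lemma degree_image:
  assumes "inj_on f V" "G \<subseteq> nsets V 2" "v \<in> V"
  shows "degree ((`) f ` G) (f v) = degree G v"
proof -
  have sub: "e \<subseteq> V" if "e \<in> G" for e using assms(2) that by (auto simp: nsets_def)
  have "f v \<in> f ` e \<longleftrightarrow> v \<in> e" if "e \<in> G" for e
    using inj_on_image_mem_iff[OF assms(1,3) sub[OF that]] .
  then have "{e \<in> (`) f ` G. f v \<in> e} = (`) f ` {e \<in> G. v \<in> e}" by blast
  moreover have "inj_on ((`) f) {e \<in> G. v \<in> e}"
    using sub by (intro inj_on_subset[OF inj_on_image_Pow[OF assms(1)]]) auto
  ultimately show ?thesis by (simp add: degree_def card_image)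
qed

lemma weight_image:
  assumes "bij_betw f {1..n} {1..n}" "G \<subseteq> nsets {1..n} 2"
  shows "weight n ((`) f ` G) = weight n G"
  unfolding weight_def
  by (subst sum.reindex_bij_betw[OF assms(1), symmetric])
    (use assms in \<open>auto simp: bij_betw_def degree_image intro!: sum.cong\<close>)

lemma image_in_graphs:
  assumes "bij_betw f {1..n} {1..n}" "G \<in> graphs n m"
  shows "(`) f ` G \<in> graphs n m"
proof -
  have b: "bij_betw ((`) f) (nsets {1..n} 2) (nsets {1..n} 2)"
    using bij_betw_nsets[OF assms(1)] .
  have "G \<subseteq> nsets {1..n} 2" "card G = m" using assms(2) by (auto simp: graphs_def)
  moreover then have "inj_on ((`) f) G" using b by (auto simp: bij_betw_def intro: inj_on_subset)
  ultimately show ?thesis using b by (auto simp: graphs_def card_image bij_betw_def)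
qed

lemma graph_iso_trans:
  assumes "graph_iso n G H" "graph_iso n H K"
  shows "graph_iso n G K"
proof -
  obtain f g where "bij_betw f {1..n} {1..n}" "(`) f ` G = H"
      "bij_betw g {1..n} {1..n}" "(`) g ` H = K"
    using assms unfolding graph_iso_def by blast
  then have "bij_betw (g \<circ> f) {1..n} {1..n}" "(`) (g \<circ> f) ` G = K"
    by (auto intro: bij_betw_trans simp: image_comp[symmetric] image_image)
  then show ?thesis unfolding graph_iso_def by blast
qed

lemma graph_iso_sym:
  assumes "graph_iso n G H" "G \<subseteq> nsets {1..n} 2"
  shows "graph_iso n H G"
proof -
  obtain f where f: "bij_betw f {1..n} {1..n}" "(`) f ` G = H"
    using assms(1) unfolding graph_iso_def by blast
  let ?g = "inv_into {1..n} f"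
  have "?g ` (f ` e) = e" if "e \<in> G" for e
  proof -
    have "e \<subseteq> {1..n}" using that assms(2) by (auto simp: nsets_def)
    then show ?thesis using f(1) by (metis bij_betw_def inv_into_image_cancel)
  qed
  then have "(`) ?g ` H = G" using f(2) by (auto simp: image_image)
  then show ?thesis using bij_betw_inv_into[OF f(1)] unfolding graph_iso_def by blast
qed

section \<open>The dense case\<close>

text \<open>Containing the complete graph on \<open>{1..n-1}\<close> makes the complement of
  \<open>Q\<close> a star around \<open>n\<close>. If the complement of \<open>H\<close> were no
  star, its edge sum would be smaller and \<open>Q\<close> would have smaller weight than
  \<open>H\<close>; so both complements are stars of equal size.\<close>

lemma minimal_iso_dense:
  assumes "n > 0" "n - 1 choose 2 \<le> m" "minimal n m H"
    and Q: "Q \<in> graphs n m" "nsets {1..n-1} 2 \<subseteq> Q"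
  shows "graph_iso n Q H"
proof -
  let ?N = "nsets {1..n} 2"
  let ?K = "?N - Q" and ?L = "?N - H"
  have fin: "finite ?N" by (simp add: finite_imp_finite_nsets)
  have H: "H \<subseteq> ?N" "card H = m" and Q': "Q \<subseteq> ?N" "card Q = m"
    using assms(3) Q(1) by (auto simp: graphs_def minimal_def)
  have cards: "card ?K = (n choose 2) - m" "card ?L = (n choose 2) - m"
    using H Q' fin by (auto simp: card_Diff_subset finite_subset card_nsets_two simp del: One_nat_def)
  \<comment> \<open>With this identity the complement has at most \<open>n - 1\<close> edges, as the
    edge sum bounds require.\<close>
  have "n choose 2 = (n - 1 choose 2) + (n - 1)"
    using choose_two_Suc[of "n - 1"] assms(1) by simp
  then have c: "card ?L < n" "card ?K = card ?L" using cards assms(1,2) by auto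
  have K: "\<forall>e\<in>?K. n \<in> e"
  proof (rule ccontr)
    assume "\<not> ?thesis"
    then obtain e where e: "e \<in> ?N" "e \<notin> Q" "n \<notin> e" by blast
    then have "e \<subseteq> {1..n-1}"
      by (auto simp: nsets_def subset_iff) (metis One_nat_def Suc_pred diff_le_self le_less less_Suc_eq_le assms(1))
    then have "e \<in> nsets {1..n-1} 2" using e(1) by (auto simp: nsets_def)
    then show False using e(2) Q(2) by blast
  qed
  have "\<exists>u\<in>{1..n}. \<forall>e\<in>?L. u \<in> e"
  proof (rule ccontr)
    assume "\<not> ?thesis"
    then have "(\<Sum>e\<in>?L. \<Sum>v\<in>e. 1 / (real n - degree ?L v))
        < (\<Sum>e\<in>?K. \<Sum>v\<in>e. 1 / (real n - degree ?K v))"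
      using edge_sum_non_star[of ?L n] edge_sum_star[of ?K n n] K c assms(1) by auto
    then have "weight n Q < weight n H"
      using assms(1) by (simp only: weight_via_complement[OF H(1)] weight_via_complement[OF Q'(1)]
          diff_less_eq less_diff_eq) (simp add: divide_strict_right_mono)
    then show False using assms(3) Q(1) by (auto simp: minimal_def)
  qed
  then obtain u where "u \<in> {1..n}" "\<forall>e\<in>?L. u \<in> e" by blast
  then have "graph_iso n ?K ?L"
    using stars_isomorphic[of ?K n n ?L u] K c assms(1) by auto
  then show ?thesis by (rule graph_iso_of_complements[OF Q'(1) H(1)])
qed

section \<open>The sparse case: an isolated vertex\<close>

text \<open>For \<open>b > 0\<close> the exact increase is
  \<open>b / ((a + 1) * (a + b + 1))\<close>, and \<open>a + b + 1\<close> is at least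
  \<open>k + 2\<close>. Since the bound is linear in \<open>b\<close>, only the total of the added
  degrees matters, not where the new edges go.\<close>

lemma increment_bound:
  fixes a b k :: nat
  assumes "k \<le> a"
  shows "real (a + b) / (real (a + b) + 1)
    \<le> real a / (real a + 1) + real b / ((real k + 1) * (real k + 2))"
proof (cases "b = 0")
  case False
  have "real (a + b) / (real (a + b) + 1) - real a / (real a + 1)
      = real b / ((real a + 1) * (real a + real b + 1))"
    by (simp add: divide_simps) (simp add: algebra_simps)
  also have "\<dots> \<le> real b / ((real k + 1) * (real k + 2))"
    using assms False by (intro divide_left_mono mult_mono mult_pos_pos) auto
  finally show ?thesis by simp
qed simp

lemma minimal_has_isolated:
  assumes min: "minimal n m H" and "n > 0" "m \<le> (n - 1 choose 2)"
  shows "\<exists>v\<in>{1..n}. degree H v = 0"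
proof (rule ccontr)
  assume no_isolated: "\<not> ?thesis"
  let ?V = "{1..n}"
  have pos: "degree H v > 0" if "v \<in> ?V" for v
    using no_isolated that by (metis gr0I)
  have H: "H \<subseteq> nsets ?V 2" "card H = m" using min by (auto simp: minimal_def graphs_def)
  have finH: "finite H" using H(1) finite_imp_finite_nsets finite_subset by blast
  \<comment> \<open>Minimality of the degree \<open>k\<close> of \<open>v\<close> lets
    \<open>increment_bound\<close> be used with the same \<open>k\<close> at every other
    vertex.\<close>
  obtain v where v: "v \<in> ?V" "\<forall>u\<in>?V. degree H v \<le> degree H u"
    using ex_is_arg_min_if_finite[of ?V "degree H"] assms(2)
    by (auto simp: is_arg_min_def not_less)
  define k where "k = degree H v"
  have k: "k > 0" using pos v(1) by (simp add: k_def)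
  let ?W = "?V - {v}"
  let ?E = "{e\<in>H. v \<in> e}"
  define G where "G = H - ?E"
  have G: "G \<subseteq> nsets ?W 2" using H(1) by (auto simp: G_def nsets_def)
  have finW: "finite (nsets ?W 2)" by (simp add: finite_imp_finite_nsets)
  have finG: "finite G" using G finW finite_subset by blast
  have cE: "card ?E = k" by (simp add: k_def degree_def)
  have cG: "card G + k = m"
    using cE H(2) finH card_mono[of H ?E] by (auto simp: G_def card_Diff_subset)
  have "card (nsets ?W 2) = (n - 1 choose 2)"
    using v(1) by (simp add: card_nsets)
  \<comment> \<open>Room for the new edges: \<open>G\<close> has \<open>m - k\<close> edges, and
    \<open>m\<close> is at most the number of pairs avoiding \<open>v\<close>.\<close>
  then have "k \<le> card (nsets ?W 2 - G)"
    using G finG cG assms(3) by (simp add: card_Diff_subset)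
  then obtain A where A: "A \<subseteq> nsets ?W 2 - G" "card A = k" "finite A"
    using obtain_subset_with_card_n by metis
  define H' where "H' = G \<union> A"
  have "card H' = m"
  proof -
    have "G \<inter> A = {}" using A(1) by blast
    then show ?thesis using A cG finG by (simp add: H'_def card_Un_disjoint)
  qed
  moreover have subW: "H' \<subseteq> nsets ?W 2" using G A by (auto simp: H'_def)
  then have "H' \<subseteq> nsets ?V 2" by (auto simp: nsets_def)
  ultimately have H': "H' \<in> graphs n m" by (simp add: graphs_def)
  have dv: "degree H' v = 0" using subW by (rule degree_outside) simp
  \<comment> \<open>The degree lost by the former neighbours of \<open>v\<close> is simply
    discarded.\<close>
  have du: "degree H' u \<le> degree H u + degree A u" for u
  proof -
    have "degree H' u = degree G u + degree A u"
      unfolding H'_def using A finG by (intro degree_Un_disjoint) auto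
    moreover have "degree G u \<le> degree H u"
      unfolding degree_def using finH by (intro card_mono) (auto simp: G_def)
    ultimately show ?thesis by simp
  qed
  have "(\<Sum>u\<in>?W. real (degree A u) * 1) = (\<Sum>e\<in>A. \<Sum>v\<in>e. 1)"
    using A by (intro sum_degree_weighted) auto
  also have "\<dots> = (\<Sum>e\<in>A. 2)" using A by (intro sum.cong) (auto simp: nsets_def)
  finally have sumA: "(\<Sum>u\<in>?W. real (degree A u)) = 2 * real k" using A by simp
  let ?g = "\<lambda>x::real. x / (x + 1)"
  let ?P = "(real k + 1) * (real k + 2)"
  have mono: "?g (real a) \<le> ?g (real b)" if "a \<le> b" for a b
    using that by (simp add: divide_simps) (simp add: algebra_simps)
  have wt: "weight n F = ?g (degree F v) + (\<Sum>u\<in>?W. ?g (degree F u))" for F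
    unfolding weight_def using v(1) by (simp add: sum.remove)
  have "weight n H' = (\<Sum>u\<in>?W. ?g (degree H' u))" by (simp add: wt dv)
  also have "\<dots> \<le> (\<Sum>u\<in>?W. ?g (degree H u) + real (degree A u) / ?P)"
  proof (rule sum_mono)
    fix u assume "u \<in> ?W"
    then have "k \<le> degree H u" using v(2) by (simp add: k_def)
    from order_trans[OF mono[OF du] increment_bound[OF this]]
    show "?g (degree H' u) \<le> ?g (degree H u) + real (degree A u) / ?P" .
  qed
  also have "\<dots> = (\<Sum>u\<in>?W. ?g (degree H u)) + 2 * real k / ?P"
    using sumA by (simp add: sum.distrib flip: sum_divide_distrib)
  \<comment> \<open>The comparison reduces to \<open>2 / (k + 2) < 1\<close>; here the assumption
    that no vertex is isolated enters, through \<open>k > 0\<close>.\<close>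
  also have "2 * real k / ?P < ?g (real k)"
    using k by (simp add: divide_simps)
  finally have "weight n H' < weight n H" by (simp add: wt k_def)
  then show False using min H' by (auto simp: minimal_def)
qed

section \<open>Adding an isolated vertex\<close>

lemma graphs_mono: "G \<in> graphs n m \<Longrightarrow> n \<le> n' \<Longrightarrow> G \<in> graphs n' m"
  using nsets_mono[of "{1..n}" "{1..n'}" 2] by (auto simp: graphs_def)

lemma weight_Suc:
  assumes "G \<in> graphs n m"
  shows "weight (Suc n) G = weight n G"
proof -
  have "degree G (Suc n) = 0"
    by (rule degree_outside[of G "{1..n}"]) (use assms in \<open>auto simp: graphs_def\<close>)
  then show ?thesis by (simp add: weight_def)
qed

lemma graph_iso_Suc:
  assumes "graph_iso n G H" "G \<in> graphs n m"
  shows "graph_iso (Suc n) G H"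
proof -
  obtain f where f: "bij_betw f {1..n} {1..n}" "(`) f ` G = H"
    using assms(1) unfolding graph_iso_def by blast
  let ?h = "\<lambda>x. if x = Suc n then Suc n else f x"
  have "bij_betw ?h {1..n} {1..n}"
    using f(1) by (rule bij_betw_cong[THEN iffD1, rotated]) auto
  then have "bij_betw ?h ({1..n} \<union> {Suc n}) ({1..n} \<union> {Suc n})"
    by (rule bij_betw_combine) auto
  moreover have "{1..n} \<union> {Suc n} = {1..Suc n}" by auto
  moreover have "(`) ?h ` G = H"
  proof -
    have "?h ` e = f ` e" if "e \<in> G" for e
    proof -
      have "e \<subseteq> {1..n}" using that assms(2) by (auto simp: graphs_def nsets_def)
      then have "x \<noteq> Suc n" if "x \<in> e" for x using that by auto
      then show ?thesis by (intro image_cong) auto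
    qed
    then show ?thesis using f(2) by auto
  qed
  ultimately show ?thesis unfolding graph_iso_def by metis
qed

text \<open>The bound on \<open>m\<close> forces \<open>q < n\<close>, so the partially joined
  vertex \<open>q + 1\<close> is already present and both sides take the same branch in
  \<open>QK\<close>.\<close>

lemma QK_Suc:
  assumes "m < n choose 2"
  shows "QK (Suc n) m = QK n m"
proof -
  obtain q r where qr: "m = (q choose 2) + r" "r < q" using qk_decomp_ex by blast
  have "q < n"
  proof (rule ccontr)
    assume "\<not> q < n"
    then show False using choose_two_mono[of n q] qr assms by simp
  qed
  then show ?thesis by (simp add: QK_def qk_params_eqI[OF qr])
qed

text \<open>If \<open>q < n\<close>, then \<open>m < (Suc q choose 2)\<close>, which is at most
  \<open>n choose 2\<close>; hence the clique of \<open>QK\<close> has at least \<open>n\<close>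
  vertices.\<close>

lemma complete_subset_QK:
  assumes "n choose 2 \<le> m"
  shows "nsets {1..n} 2 \<subseteq> QK n' m"
proof -
  obtain q r where qr: "m = (q choose 2) + r" "r < q" using qk_decomp_ex by blast
  have "n \<le> q"
  proof (rule ccontr)
    assume "\<not> n \<le> q"
    then show False using choose_two_mono[of "Suc q" n] qr assms by (simp add: choose_two_Suc)
  qed
  then have "nsets {1..n} 2 \<subseteq> nsets {1..q} 2" by (intro nsets_mono) auto
  then show ?thesis by (auto simp: QK_def qk_params_eqI[OF qr])
qed

section \<open>Induction on the number of vertices\<close>

lemma minimal_isomorphic_QK:
  assumes "n > 0" "m \<le> n choose 2" "minimal n m H"
  shows "graph_iso n (QK n m) H"
  using assms
proof (induction n arbitrary: H rule: nat_induct_non_zero)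
  case 1
  \<comment> \<open>A single vertex falls under the dense case, where the required complete subgraph
    lives on the empty vertex set.\<close>
  have "nsets {1..1 - 1} 2 = ({} :: nat set set)" by (simp add: nsets_empty_iff)
  then show ?case
    using minimal_iso_dense[of 1 m H "QK 1 m"] QK_in_graphs[of m 1] 1 by (simp add: numeral_2_eq_2)
next
  case (Suc n)
  let ?V = "{1..Suc n}"
  show ?case
  proof (cases "n choose 2 \<le> m")
    case True
    then show ?thesis
      using minimal_iso_dense[of "Suc n" m H] QK_in_graphs Suc.prems complete_subset_QK by simp
  next
    case False
    then obtain v where v: "v \<in> ?V" "degree H v = 0"
      using minimal_has_isolated[of "Suc n" m H] Suc.prems by auto
    have H: "H \<in> graphs (Suc n) m" using Suc.prems by (simp add: minimal_def)
    then have Hsub: "H \<subseteq> nsets ?V 2" by (simp add: graphs_def)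
    \<comment> \<open>Swapping the isolated vertex with \<open>Suc n\<close> leaves all edges inside
      \<open>{1..n}\<close>, where the induction hypothesis applies.\<close>
    define f where "f = transpose v (Suc n)"
    have f: "bij_betw f ?V ?V" using v(1) by (simp add: f_def)
    define L where "L = (`) f ` H"
    have iso: "graph_iso (Suc n) H L" using f by (auto simp: graph_iso_def L_def)
    have L: "L \<in> graphs (Suc n) m" using image_in_graphs[OF f H] by (simp add: L_def)
    have "degree L (f v) = degree H v"
      using f Hsub v(1) unfolding L_def by (intro degree_image) (auto simp: bij_betw_def)
    then have "degree L (Suc n) = 0" using v(2) by (simp add: f_def)
    then have "\<forall>e\<in>L. Suc n \<notin> e" using finite_graph[OF L] by (auto simp: degree_def)
    then have Ln: "L \<in> graphs n m"
      using L by (auto simp: graphs_def nsets_def subset_iff) (metis le_Suc_eq)+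
    \<comment> \<open>Minimality descends: a competitor on \<open>n\<close> vertices is also one on
      \<open>Suc n\<close> vertices, of the same weight.\<close>
    have "weight n L \<le> weight n F" if "F \<in> graphs n m" for F
    proof -
      have "weight (Suc n) H \<le> weight (Suc n) F"
        using Suc.prems graphs_mono[OF that, of "Suc n"] by (simp add: minimal_def)
      then show ?thesis
        using weight_image[OF f Hsub] weight_Suc[OF Ln] weight_Suc[OF that] by (simp add: L_def)
    qed
    then have "minimal n m L" using Ln by (simp add: minimal_def)
    then have "graph_iso n (QK n m) L" using Suc.IH False by simp
    then have "graph_iso (Suc n) (QK n m) L"
      using QK_in_graphs[of m n] False Suc.hyps by (intro graph_iso_Suc) auto
    moreover have "QK (Suc n) m = QK n m" using False by (intro QK_Suc) simp
    ultimately show ?thesis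
      using graph_iso_trans graph_iso_sym[OF iso Hsub] by metis
  qed
qed

theorem mainTheorem3:
  fixes n m :: nat
  assumes "n > 0" and "m \<le> n choose 2"
  shows "uniquely_minimizes (\<lambda>x. x / (x + 1)) n m (QK n m)"
proof -
  have QK: "QK n m \<in> graphs n m" using assms by (intro QK_in_graphs)
  \<comment> \<open>Optimality of \<open>QK n m\<close> needs no direct estimate: some minimizer
    exists by finiteness, it is isomorphic to \<open>QK n m\<close>, and isomorphic graphs have
    equal weight.\<close>
  then obtain M where M: "minimal n m M" using minimal_exists by blast
  obtain f where f: "bij_betw f {1..n} {1..n}" "(`) f ` QK n m = M"
    using minimal_isomorphic_QK[OF assms M] unfolding graph_iso_def by blast
  have "weight n M = weight n (QK n m)"
    using weight_image[OF f(1)] f(2) QK by (auto simp: graphs_def)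
  then have "minimal n m (QK n m)" using M QK by (simp add: minimal_def)
  then show ?thesis
    using QK minimal_isomorphic_QK[OF assms]
    by (auto simp: uniquely_minimizes_def attains_min_iff_minimal)
qed

end
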